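(* Let $r\ne0$ be real, let $I=[I_{uv}]_{1\le u\le k,1\le v\le\ell}$ be a convex $0/1$ array, and let $0=\mathrm x_0<\dots<\mathrm x_k=1$, $0=\mathrm y_0<\dots<\mathrm y_\ell=1$. Let $\phi,\psi:[0,1]\to\mathbb R\cup\{\infty\}$ be continuous functions such that $$g(x,y)=-\frac1r\cdot\frac{\frac{\partial}{\partial x}\phi(x)\,\frac{\partial}{\partial y}\psi(y)}{[\phi(x)-\psi(y)]^2}$$ is non-negative for $(x,y)\in(\mathrm x_{u-1},\mathrm x_u)\times(\mathrm y_{v-1},\mathrm y_v)$ whenever $I_{uv}=1$ and satisfies the uniform marginal conditions $$\sum_{v=1}^\ell I_{uv}\int_{\mathrm y_{v-1}}^{\mathrm y_v}g(x,y)\,dy=1,\quad x\in(\mathrm x_{u-1},\mathrm x_u),\ 1\le u\le k;\qquad \sum_{u=1}^k I_{uv}\int_{\mathrm x_{u-1}}^{\mathrm x_u}g(x,y)\,dx=1,\quad y\in(\mathrm y_{v-1},\mathrm y_v),\ 1\le v\le\ell.$$ Then the $k+\ell+2$ values $\phi(\mathrm x_u)$, $0\le u\le k$, and $\psi(\mathrm y_v)$, $0\le v\le\ell$, solve the $k+\ell$ equations $$e^{r(\mathrm x_u-\mathrm x_{u-1})}=\prod_{v=1}^\ell\left[\frac{\psi(\mathrm y_v)-\phi(\mathrm x_{u-1})}{\psi(\mathrm y_{v-1})-\phi(\mathrm x_{u-1})}\cdot\frac{\psi(\mathrm y_{v-1})-\phi(\mathrm x_u)}{\psi(\mathrm y_v)-\phi(\mathrm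 x_u)}\right]^{I_{uv}},\quad 1\le u\le k,$$ $$e^{r(\mathrm y_v-\mathrm y_{v-1})}=\prod_{u=1}^k\left[\frac{\psi(\mathrm y_v)-\phi(\mathrm x_{u-1})}{\psi(\mathrm y_{v-1})-\phi(\mathrm x_{u-1})}\cdot\frac{\psi(\mathrm y_{v-1})-\phi(\mathrm x_u)}{\psi(\mathrm y_v)-\phi(\mathrm x_u)}\right]^{I_{uv}},\quad 1\le v\le\ell,$$ and the values at other points satisfy $$e^{r(x-\mathrm x_{u-1})}=\prod_{v=1}^\ell\left[\frac{\psi(\mathrm y_{v-1})-\phi(x)}{\psi(\mathrm y_v)-\phi(x)}\cdot\frac{\psi(\mathrm y_v)-\phi(\mathrm x_{u-1})}{\psi(\mathrm y_{v-1})-\phi(\mathrm x_{u-1})}\right]^{I_{uv}},\quad x\in[\mathrm x_{u-1},\mathrm x_u],\ 1\le u\le k,$$ $$e^{r(y-\mathrm y_{v-1})}=\prod_{u=1}^k\left[\frac{\psi(y)-\phi(\mathrm x_{u-1})}{\psi(y)-\phi(\mathrm x_u)}\cdot\frac{\psi(\mathrm y_{v-1})-\phi(\mathrm x_u)}{\psi(\mathrm y_{v-1})-\phi(\mathrm x_{u-1})}\right]^{I_{uv}},\quad y\in[\mathrm y_{v-1},\mathrm y_v],\ 1\le v\le\ell.$$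
   Context: Convex array: for each $u$ the set $\{v:I_{uv}=1\}$ is a non-empty segment of consecutive integers, and for each $v$ the set $\{u:I_{uv}=1\}$ is a non-empty segment of consecutive integers ($u$ indexes the horizontal and $v$ the vertical direction). $\mathbb R\cup\{\infty\}$ is the extended real line (real projective line, with a single point at infinity). It is understood that $\phi$ and $\psi$ take the value $\infty$ at finitely many points, that the restrictions of $\phi$ to each $[\mathrm x_{u-1},\mathrm x_u]$ and of $\psi$ to each $[\mathrm y_{v-1},\mathrm y_v]$ are continuously differentiable as maps to the projective line (one-sided derivatives at end-points), and that $\phi(x)\ne\psi(y)$ for $(x,y)\in[\mathrm x_{u-1},\mathrm x_u]\times[\mathrm y_{v-1},\mathrm y_v]$ whenever $I_{uv}=1$. At points where $\phi$ or $\psi$ is infinite the formula for $g$ is understood by continuity, and cross-ratios involving $\infty$ are understood by the usual limiting convention. Finding such $\phi,\psi$ is how smooth solutions of the Euler–Lagrange equations for the permuton energy (with density $g$ on the rectangles with $I_{uv}=1$ and $0$ elsewhere) are obtained for convex $I$. *)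

theory Defs
  imports "HOL-Analysis.Analysis"
begin

definition convex_array :: "nat \<Rightarrow> nat \<Rightarrow> (nat \<Rightarrow> nat \<Rightarrow> nat) \<Rightarrow> bool" where
  "convex_array k l I \<longleftrightarrow>
     (\<forall>u\<in>{1..k}. \<forall>v\<in>{1..l}. I u v \<in> {0, 1}) \<and>
     (\<forall>u\<in>{1..k}. \<exists>a b. a \<le> b \<and> {v \<in> {1..l}. I u v = 1} = {a..b}) \<and>
     (\<forall>v\<in>{1..l}. \<exists>a b. a \<le> b \<and> {u \<in> {1..k}. I u v = 1} = {a..b})"

text \<open>
  The real projective line is the one-point compactification of the reals:
  \<open>Some t\<close> is the real number \<open>t\<close> and \<open>None\<close> is the single point at infinity.
\<close>

type_synonym proj_real = "real option"

definition proj_line :: "proj_real topology" where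
  "proj_line = Alexandroff_compactification euclidean"

text \<open>
  The two standard charts. \<open>coord\<close> is used only away from \<open>None\<close>, \<open>inv_coord\<close> only away
  from \<open>Some 0\<close>, so \<open>coord None = 0\<close> and \<open>inv_coord (Some 0) = 0\<close> are junk values, while
  \<open>inv_coord None = 0\<close> is the genuine value of that chart at infinity.
\<close>

definition coord :: "proj_real \<Rightarrow> real" where
  "coord p = (case p of Some t \<Rightarrow> t | None \<Rightarrow> 0)"

definition inv_coord :: "proj_real \<Rightarrow> real" where
  "inv_coord p = (case p of Some t \<Rightarrow> inverse t | None \<Rightarrow> 0)"

text \<open>
  Derivatives are taken within \<open>S\<close>, hence one-sided at the end-points of an interval
  (the library's \<open>C1_differentiable_on\<close> asks for two-sided derivatives).
\<close>

definition C1_within :: "real set \<Rightarrow> (real \<Rightarrow> real) \<Rightarrow> bool" where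
  "C1_within S f \<longleftrightarrow>
     (\<exists>D. continuous_on S D \<and> (\<forall>x\<in>S. (f has_real_derivative D x) (at x within S)))"

definition proj_C1_on :: "real set \<Rightarrow> (real \<Rightarrow> proj_real) \<Rightarrow> bool" where
  "proj_C1_on S f \<longleftrightarrow>
     continuous_map (top_of_set S) proj_line f \<and>
     C1_within {x \<in> S. f x \<noteq> None} (\<lambda>x. coord (f x)) \<and>
     C1_within {x \<in> S. f x \<noteq> Some 0} (\<lambda>x. inv_coord (f x))"

text \<open>
  The density \<open>g\<close>. Where \<open>\<phi> x\<close> or \<open>\<psi> y\<close> is infinite, its value is the limit of the formula
  through the points at which both functions are finite.
\<close>

definition density_formula ::
    "real \<Rightarrow> (real \<Rightarrow> proj_real) \<Rightarrow> (real \<Rightarrow> proj_real) \<Rightarrow> real \<Rightarrow> real \<Rightarrow> real" where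
  "density_formula r \<phi> \<psi> x y =
     - (1 / r) * (deriv (\<lambda>s. coord (\<phi> s)) x * deriv (\<lambda>t. coord (\<psi> t)) y
                  / (coord (\<phi> x) - coord (\<psi> y))\<^sup>2)"

definition permuton_density ::
    "real \<Rightarrow> (real \<Rightarrow> proj_real) \<Rightarrow> (real \<Rightarrow> proj_real) \<Rightarrow> real \<Rightarrow> real \<Rightarrow> real" where
  "permuton_density r \<phi> \<psi> x y =
     (if \<phi> x \<noteq> None \<and> \<psi> y \<noteq> None then density_formula r \<phi> \<psi> x y
      else Lim (at (x, y) within {(s, t). \<phi> s \<noteq> None \<and> \<psi> t \<noteq> None})
             (\<lambda>(s, t). density_formula r \<phi> \<psi> s t))"

text \<open>
  \<open>proj_diff p q\<close> is the determinant of the homogeneous coordinates of \<open>p\<close> and \<open>q\<close>, where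
  \<open>Some t\<close> has coordinates \<open>(t, 1)\<close> and \<open>None\<close> has coordinates \<open>(1, 0)\<close>. In the cross-ratio
  \<open>(a - c) / (b - c) * ((b - d) / (a - d))\<close> every argument occurs once above and once below,
  so that infinite arguments cancel; the lemmas below confirm the limiting convention.
\<close>

definition proj_diff :: "proj_real \<Rightarrow> proj_real \<Rightarrow> real" where
  "proj_diff p q =
     (case (p, q) of
        (Some s, Some t) \<Rightarrow> s - t
      | (None, Some t) \<Rightarrow> 1
      | (Some s, None) \<Rightarrow> - 1
      | (None, None) \<Rightarrow> 0)"

definition cross_ratio :: "proj_real \<Rightarrow> proj_real \<Rightarrow> proj_real \<Rightarrow> proj_real \<Rightarrow> real" where
  "cross_ratio a b c d =
     (proj_diff a c / proj_diff b c) * (proj_diff b d / proj_diff a d)"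

lemma cross_ratio_finite:
  "cross_ratio (Some a) (Some b) (Some c) (Some d) = (a - c) / (b - c) * ((b - d) / (a - d))"
  by (simp add: cross_ratio_def proj_diff_def)

lemma cross_ratio_infinite_limit:
  assumes "c \<noteq> None" "d \<noteq> None"
  shows "((\<lambda>t. cross_ratio (Some t) b c d) \<longlongrightarrow> cross_ratio None b c d) at_infinity"
proof -
  obtain s t where [simp]: "c = Some s" "d = Some t"
    using assms by auto
  have lim: "((\<lambda>x. (x - s) / (x - t)) \<longlongrightarrow> 1) at_infinity"
  proof -
    have "((\<lambda>x. 1 + (t - s) * inverse (x - t)) \<longlongrightarrow> 1 + (t - s) * 0) at_infinity"
      by (intro tendsto_intros filterlim_compose[OF tendsto_inverse_0]
            tendsto_add_filterlim_at_infinity'[where c = "- t" and g = "\<lambda>_. - t", simplified]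
            filterlim_ident)
    moreover have "\<forall>\<^sub>F x in at_infinity. 1 + (t - s) * inverse (x - t) = (x - s) / (x - t)"
      unfolding eventually_at_infinity
      by (rule exI[of _ "\<bar>t\<bar> + 1"]) (auto simp: field_simps)
    ultimately show ?thesis
      by (simp add: tendsto_cong)
  qed
  have "((\<lambda>x. (x - s) / (x - t) * (proj_diff b d / proj_diff b c))
          \<longlongrightarrow> 1 * (proj_diff b d / proj_diff b c)) at_infinity"
    by (intro tendsto_mult lim tendsto_const)
  then show ?thesis
    by (simp add: cross_ratio_def proj_diff_def mult_ac divide_simps)
qed

lemma cross_ratio_symmetries:
  "cross_ratio b a d c = cross_ratio a b c d"
  "cross_ratio c d a b = cross_ratio a b c d"
  by (auto simp: cross_ratio_def proj_diff_def divide_simps algebra_simps split: option.split)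

end

theory Submission
  imports Defs
begin

text \<open>
  Fix a finite value \<open>t = \<phi> x\<close>. The chart \<open>q \<mapsto> 1 / (t - q)\<close> carries the projective line minus \<open>t\<close>
  onto the reals, and in it \<open>\<psi>'(y) / (t - \<psi>(y))\<^sup>2\<close> is the derivative of \<open>1 / (t - \<psi>(y))\<close>. The chart is
  continuous at infinity, so \<open>\<psi>\<close> may pass through infinity in the middle of a segment: by the
  fundamental theorem of calculus with finitely many exceptional points
  (\<open>has_integral_recip_diff\<close>), the integral of the density over a segment is \<open>- \<phi>'(x) / r\<close> times
  the increment of \<open>1 / (\<phi>(x) - q)\<close> as \<open>q\<close> passes from the lower to the upper end value of \<open>\<psi>\<close>.

  On the other hand this increment, times \<open>- \<phi>'(x)\<close>, is also the logarithmic derivative in \<open>x\<close> of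
  the cross-ratio of the two end values of \<open>\<psi>\<close> with a fixed base value and \<open>\<phi>(x)\<close>
  (\<open>DERIV_cross_ratio_last\<close>). The marginal condition at \<open>x\<close> therefore says that the product of these
  cross-ratios, call it \<open>P\<close>, satisfies \<open>P'(x) = r P(x)\<close>. This is known off the finitely many \<open>x\<close> with \<open>\<phi>(x)\<close> infinite, and \<open>P\<close> is
  continuous everywhere with value 1 at the left end-point, hence \<open>P(x) = exp (r (x - p))\<close> with
  \<open>p\<close> the left end-point.

  Cross-ratios are unchanged under exchanging and reversing the two pairs, and so is the density
  formula under exchanging \<open>\<phi>\<close> and \<open>\<psi>\<close>; one argument (\<open>marginal_imp_cross_ratio_product\<close>) thus gives both
  families of identities along a segment, and the identities at the grid points are their values at
  the right end-points.
\<close>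

section \<open>Functions on the projective line\<close>

text \<open>
  A neighbourhood of infinity contains all real numbers of sufficiently large absolute value, and
  such sets of numbers generate the neighbourhoods, so continuity of a function on the projective line can be tested in the affine coordinate. This form is needed
  because the charts in question are continuous only on the part of the line that \<open>\<psi>\<close> visits.
\<close>

lemma continuous_on_proj_compose:
  fixes \<psi> :: "'a :: topological_space \<Rightarrow> proj_real" and f :: "proj_real \<Rightarrow> 'b :: topological_space"
  assumes \<psi>: "continuous_map (top_of_set S) proj_line \<psi>"
    and fin: "\<And>y t. y \<in> S \<Longrightarrow> \<psi> y = Some t \<Longrightarrow> isCont (\<lambda>t. f (Some t)) t"
    and inf: "\<And>y. y \<in> S \<Longrightarrow> \<psi> y = None \<Longrightarrow> ((\<lambda>t. f (Some t)) \<longlongrightarrow> f None) at_infinity"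
  shows "continuous_on S (\<lambda>y. f (\<psi> y))"
  unfolding continuous_on_topological
proof (intro ballI allI impI)
  fix y B assume y: "y \<in> S" and B: "open B" "f (\<psi> y) \<in> B"
  have "\<exists>W. openin proj_line W \<and> \<psi> y \<in> W \<and> f ` W \<subseteq> B"
  proof (cases "\<psi> y")
    case (Some t)
    have "((\<lambda>s. f (Some s)) \<longlongrightarrow> f (Some t)) (nhds t)"
      using fin[OF y Some] tendsto_at_iff_tendsto_nhds[of \<open>\<lambda>s. f (Some s)\<close> t]
      by (simp add: isCont_def)
    then have "\<forall>\<^sub>F s in nhds t. f (Some s) \<in> B"
      using B unfolding Some by (rule topological_tendstoD)
    then obtain V where "open V" "t \<in> V" "\<forall>s\<in>V. f (Some s) \<in> B"
      unfolding eventually_nhds by auto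
    then show ?thesis
      by (intro exI[of _ "Some ` V"]) (auto simp: Some proj_line_def)
  next
    case None
    obtain R where R: "\<forall>s. R \<le> norm s \<longrightarrow> f (Some s) \<in> B"
      using topological_tendstoD[OF inf[OF y None] B(1)] B(2)
      unfolding None eventually_at_infinity by auto
    have "openin proj_line (insert None (Some ` (UNIV - cball 0 R)))"
      unfolding proj_line_def openin_Alexandroff_compactification
      by (intro disjI2 exI[of _ "cball 0 R"]) auto
    then show ?thesis
      using R B(2) by (intro exI[of _ "insert None (Some ` (UNIV - cball 0 R))"]) (auto simp: None)
  qed
  then obtain W where W: "openin proj_line W" "\<psi> y \<in> W" "f ` W \<subseteq> B" by auto
  have "openin (top_of_set S) {x \<in> S. \<psi> x \<in> W}"
    using openin_continuous_map_preimage[OF \<psi> W(1)] by simp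
  then obtain A where "open A" "{x \<in> S. \<psi> x \<in> W} = S \<inter> A"
    unfolding openin_open by auto
  then show "\<exists>A. open A \<and> y \<in> A \<and> (\<forall>x\<in>S. x \<in> A \<longrightarrow> f (\<psi> x) \<in> B)"
    using W y by (intro exI[of _ A]) blast
qed

lemma proj_diff_eq_0_iff: "proj_diff p q = 0 \<longleftrightarrow> p = q"
  by (auto simp: proj_diff_def split: option.splits)

text \<open>The affine chart \<open>q \<mapsto> 1 / (t - q)\<close> on the complement of the finite point \<open>t\<close>.\<close>

definition recip_diff :: "real \<Rightarrow> proj_real \<Rightarrow> real" where
  "recip_diff t q = (case q of Some s \<Rightarrow> 1 / (t - s) | None \<Rightarrow> 0)"

lemma tendsto_inverse_diff_at_infinity:
  "((\<lambda>s. 1 / (t - s)) \<longlongrightarrow> 0) at_infinity" for t :: real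
proof -
  have "((\<lambda>s. inverse (s - t)) \<longlongrightarrow> 0) at_infinity"
    by (intro filterlim_compose[OF tendsto_inverse_0]
          tendsto_add_filterlim_at_infinity'[where c = "- t" and g = "\<lambda>_. - t", simplified]
          filterlim_ident)
  from tendsto_minus[OF this] show ?thesis
    by (simp add: inverse_eq_divide minus_divide_right)
qed

lemma continuous_on_recip_diff:
  assumes "continuous_map (top_of_set S) proj_line \<psi>" "\<And>y. y \<in> S \<Longrightarrow> \<psi> y \<noteq> Some t"
  shows "continuous_on S (\<lambda>y. recip_diff t (\<psi> y))"
  by (rule continuous_on_proj_compose[OF assms(1)])
     (use assms(2) in \<open>auto simp: recip_diff_def intro!: continuous_intros tendsto_inverse_diff_at_infinity\<close>)

text \<open>
  The half of the cross-ratio that depends on its last argument, with pole at \<open>a\<close>. If \<open>a\<close> and \<open>b\<close> are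
  finite it is an affine function of the chart with pole \<open>a\<close>, which gives the limit at infinity.
\<close>

lemma continuous_on_proj_diff_ratio:
  assumes \<phi>: "continuous_map (top_of_set S) proj_line \<phi>" and a: "\<And>x. x \<in> S \<Longrightarrow> \<phi> x \<noteq> a"
  shows "continuous_on S (\<lambda>x. proj_diff b (\<phi> x) / proj_diff a (\<phi> x))"
proof (rule continuous_on_proj_compose[OF \<phi>])
  fix x t assume "x \<in> S" "\<phi> x = Some t"
  with a have "a \<noteq> Some t" by metis
  then show "isCont (\<lambda>t. proj_diff b (Some t) / proj_diff a (Some t)) t"
    by (cases a; cases b) (auto simp: proj_diff_def intro!: continuous_intros)
next
  fix x assume "x \<in> S" "\<phi> x = None"
  with a obtain s where s: "a = Some s" by (metis option.exhaust)
  show "((\<lambda>t. proj_diff b (Some t) / proj_diff a (Some t))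
           \<longlongrightarrow> proj_diff b None / proj_diff a None) at_infinity"
  proof (cases b)
    case None
    then show ?thesis
      using tendsto_inverse_diff_at_infinity[of s] by (simp add: s proj_diff_def)
  next
    case (Some w)
    have "((\<lambda>t. 1 + (w - s) * (1 / (s - t))) \<longlongrightarrow> 1 + (w - s) * 0) at_infinity"
      by (intro tendsto_intros tendsto_inverse_diff_at_infinity)
    moreover have "\<forall>\<^sub>F t in at_infinity. 1 + (w - s) * (1 / (s - t)) = (w - t) / (s - t)"
      unfolding eventually_at_infinity
      by (rule exI[of _ "\<bar>s\<bar> + 1"]) (auto simp: field_simps)
    ultimately show ?thesis
      by (simp add: tendsto_cong s Some proj_diff_def)
  qed
qed

text \<open>
  The logarithmic derivative in \<open>t\<close> of \<open>(b - t) / (a - t)\<close> is \<open>1 / (t - b) - 1 / (t - a)\<close>; in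
  homogeneous form this persists when \<open>a\<close> or \<open>b\<close> is infinite.
\<close>

lemma DERIV_proj_diff_ratio:
  assumes "a \<noteq> Some t" "b \<noteq> Some t"
  shows "((\<lambda>t. proj_diff b (Some t) / proj_diff a (Some t)) has_real_derivative
           (proj_diff b (Some t) / proj_diff a (Some t)) * (recip_diff t b - recip_diff t a)) (at t)"
proof (cases a)
  case None
  then show ?thesis
    using assms
    by (cases b) (auto simp: proj_diff_def recip_diff_def divide_simps intro!: derivative_eq_intros)
next
  case (Some s)
  then have A: "s - t \<noteq> 0" using assms by auto
  show ?thesis
  proof (cases b)
    case None
    with Some A show ?thesis
      by (auto simp: proj_diff_def recip_diff_def divide_simps intro!: derivative_eq_intros)
  next
    case (Some w)
    then have B: "w - t \<noteq> 0" using assms by auto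
    have "((\<lambda>t. (w - t) / (s - t)) has_real_derivative
             ((0 - 1) * (s - t) - (w - t) * (0 - 1)) / ((s - t) * (s - t))) (at t)"
      by (intro derivative_intros) (use A in auto)
    moreover have "((0 - 1) * (s - t) - (w - t) * (0 - 1)) / ((s - t) * (s - t))
        = (w - t) / (s - t) * (1 / - (w - t) - 1 / - (s - t))"
      using A B by (simp add: divide_simps) (simp add: algebra_simps)
    ultimately show ?thesis
      unfolding \<open>a = Some s\<close> \<open>b = Some w\<close> proj_diff_def recip_diff_def by simp
  qed
qed

section \<open>Differentiation and integration along a segment\<close>

lemma open_finite_part:
  assumes "finite {x \<in> {a..b}. f x = None}"
  shows "open {x \<in> {a<..<b :: real}. f x \<noteq> None}"
proof -
  have "{x \<in> {a<..<b}. f x \<noteq> None} = {a<..<b} - {x \<in> {a..b}. f x = None}" by auto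
  then show ?thesis
    using finite_imp_closed[OF assms] by (simp add: open_Diff)
qed

lemma proj_C1_on_DERIV:
  assumes "proj_C1_on {a..b} f" "finite {x \<in> {a..b}. f x = None}" "x \<in> {a<..<b}" "f x \<noteq> None"
  shows "((\<lambda>s. coord (f s)) has_real_derivative deriv (\<lambda>s. coord (f s)) x) (at x)"
proof -
  let ?S = "{x \<in> {a..b}. f x \<noteq> None}"
  have "C1_within ?S (\<lambda>s. coord (f s))" "x \<in> ?S"
    using assms by (auto simp: proj_C1_on_def)
  then obtain d where d: "((\<lambda>s. coord (f s)) has_real_derivative d) (at x within ?S)"
    unfolding C1_within_def by blast
  have "x \<in> interior ?S"
    by (rule interiorI[OF open_finite_part[OF assms(2)]]) (use assms in auto)
  then have d': "((\<lambda>s. coord (f s)) has_real_derivative d) (at x)"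
    using d by (simp only: at_within_interior)
  then show ?thesis
    by (simp only: DERIV_imp_deriv[OF d'])
qed

text \<open>
  With \<open>t = \<phi> x\<close> and \<open>c = - \<phi>'(x) / r\<close> the function \<open>g\<close> is the density along a vertical line. At the
  points where \<open>\<psi>\<close> is infinite only continuity of the primitive is available, and being finitely
  many they do not affect the integral.
\<close>

lemma has_integral_recip_diff:
  assumes ab: "a \<le> b" and \<psi>: "proj_C1_on {a..b} \<psi>" and fin: "finite {y \<in> {a..b}. \<psi> y = None}"
    and t: "\<And>y. y \<in> {a..b} \<Longrightarrow> \<psi> y \<noteq> Some t"
    and g: "\<And>y. y \<in> {a..b} \<Longrightarrow> \<psi> y \<noteq> None \<Longrightarrow>
              g y = c * (deriv (\<lambda>s. coord (\<psi> s)) y / (t - coord (\<psi> y))\<^sup>2)"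
  shows "(g has_integral c * (recip_diff t (\<psi> b) - recip_diff t (\<psi> a))) {a..b}"
proof -
  let ?N = "{y \<in> {a..b}. \<psi> y = None}"
  have "(g has_integral c * recip_diff t (\<psi> b) - c * recip_diff t (\<psi> a)) {a..b}"
  proof (rule fundamental_theorem_of_calculus_interior_strong[OF fin ab])
    show "continuous_on {a..b} (\<lambda>y. c * recip_diff t (\<psi> y))"
      using \<psi> t by (intro continuous_intros continuous_on_recip_diff) (auto simp: proj_C1_on_def)
  next
    fix y assume y: "y \<in> {a<..<b} - ?N"
    then have yN: "\<psi> y \<noteq> None" by auto
    have ne: "t - coord (\<psi> y) \<noteq> 0"
      using t[of y] y yN by (auto simp: coord_def)
    have "((\<lambda>s. coord (\<psi> s)) has_real_derivative deriv (\<lambda>s. coord (\<psi> s)) y) (at y)"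
      using y yN by (intro proj_C1_on_DERIV[OF \<psi> fin]) auto
    then have "((\<lambda>s. c * (1 / (t - coord (\<psi> s)))) has_real_derivative g y) (at y)"
      using y yN ne by (auto intro!: derivative_eq_intros simp: g power2_eq_square)
    then have "((\<lambda>y. c * recip_diff t (\<psi> y)) has_real_derivative g y) (at y)"
      by (rule has_field_derivative_transform_within_open[OF _ open_finite_part[OF fin]])
         (use y in \<open>auto simp: recip_diff_def coord_def\<close>)
    then show "((\<lambda>y. c * recip_diff t (\<psi> y)) has_vector_derivative g y) (at y)"
      by (simp add: has_real_derivative_iff_has_vector_derivative)
  qed
  then show ?thesis by (simp add: right_diff_distrib)
qed

lemma DERIV_cross_ratio_last:
  assumes \<phi>: "proj_C1_on {p..q} \<phi>" and fin: "finite {x \<in> {p..q}. \<phi> x = None}"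
    and x: "x \<in> {p<..<q}" and \<phi>x: "\<phi> x = Some t" and ab: "a \<noteq> Some t" "b \<noteq> Some t"
  shows "((\<lambda>x. cross_ratio a b c (\<phi> x)) has_real_derivative
            cross_ratio a b c (\<phi> x) *
              (- deriv (\<lambda>s. coord (\<phi> s)) x * (recip_diff t a - recip_diff t b))) (at x)"
proof -
  let ?f = "\<lambda>t. proj_diff b (Some t) / proj_diff a (Some t)"
  have \<phi>x': "coord (\<phi> x) = t" by (simp add: coord_def \<phi>x)
  have d: "((\<lambda>s. coord (\<phi> s)) has_real_derivative deriv (\<lambda>s. coord (\<phi> s)) x) (at x)"
    using x \<phi>x by (intro proj_C1_on_DERIV[OF \<phi> fin]) auto
  have "((\<lambda>s. ?f (coord (\<phi> s))) has_real_derivative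
          ?f t * (recip_diff t b - recip_diff t a) * deriv (\<lambda>s. coord (\<phi> s)) x) (at x)"
    using DERIV_chain2[of ?f _ "\<lambda>s. coord (\<phi> s)", OF _ d] DERIV_proj_diff_ratio[OF ab]
    unfolding \<phi>x' by blast
  then have "((\<lambda>s. proj_diff a c / proj_diff b c * ?f (coord (\<phi> s))) has_real_derivative
      proj_diff a c / proj_diff b c *
        (?f t * (recip_diff t b - recip_diff t a) * deriv (\<lambda>s. coord (\<phi> s)) x)) (at x)"
    by (rule DERIV_cmult)
  then have "((\<lambda>x. cross_ratio a b c (\<phi> x)) has_real_derivative
      proj_diff a c / proj_diff b c *
        (?f t * (recip_diff t b - recip_diff t a) * deriv (\<lambda>s. coord (\<phi> s)) x)) (at x)"
    by (rule has_field_derivative_transform_within_open[OF _ open_finite_part[OF fin]])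
       (use x \<phi>x in \<open>auto simp: cross_ratio_def coord_def\<close>)
  moreover have "proj_diff a c / proj_diff b c *
        (?f t * (recip_diff t b - recip_diff t a) * deriv (\<lambda>s. coord (\<phi> s)) x)
      = cross_ratio a b c (\<phi> x) *
          (- deriv (\<lambda>s. coord (\<phi> s)) x * (recip_diff t a - recip_diff t b))"
    unfolding cross_ratio_def \<phi>x by (simp only: algebra_simps)
  ultimately show ?thesis by simp
qed

text \<open>
  The product \<open>P x * exp (- r (x - p))\<close> has derivative 0 off a finite set and is continuous, hence
  constant. Passing to \<open>ln P\<close> instead would require the positivity of \<open>P\<close>, which comes out only
  with the conclusion.
\<close>

lemma exp_unique_of_DERIV_finite_exceptions:
  fixes P :: "real \<Rightarrow> real"
  assumes "finite N" and cont: "continuous_on {p..q} P" and "P p = 1"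
    and d: "\<And>x. x \<in> {p<..<q} - N \<Longrightarrow> (P has_real_derivative r * P x) (at x)"
    and x: "x \<in> {p..q}"
  shows "P x = exp (r * (x - p))"
proof -
  let ?Q = "\<lambda>x. P x * exp (- r * (x - p))"
  have "?Q x = 1"
    \<comment> \<open>The derivative at an end-point of the segment would be one-sided; the end-points are exempted.\<close>
  proof (rule has_derivative_zero_unique_strong_interval[of "insert p (insert q N)" p q ?Q 1, OF _ _ _ _ x])
    show "continuous_on {p..q} ?Q"
      by (intro continuous_intros cont)
    show "(?Q has_derivative (\<lambda>h. 0)) (at z within {p..q})"
      if z: "z \<in> {p..q} - insert p (insert q N)" for z
    proof -
      have "(P has_real_derivative r * P z) (at z)" using z by (intro d) auto
      then have "(?Q has_real_derivative 0) (at z)"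
        by (auto intro!: derivative_eq_intros)
      then show ?thesis
        by (simp add: has_field_derivative_def has_derivative_at_withinI lambda_zero)
    qed
  qed (use assms in auto)
  moreover have "exp (- r * (x - p)) * exp (r * (x - p)) = 1"
    by (simp flip: exp_add)
  ultimately show ?thesis
    by (metis mult.assoc mult.commute mult_1)
qed

section \<open>Marginals and cross-ratios\<close>

text \<open>
  The index set \<open>V\<close> is the set of segments in the \<open>\<psi>\<close>-direction that occur in one row or column of
  the array. Determining \<open>g\<close> by its values at finite arguments makes the hypothesis symmetric under
  exchanging \<open>\<phi>\<close> and \<open>\<psi>\<close>, so that the lemma covers rows and columns alike.
\<close>

lemma marginal_imp_cross_ratio_product:
  fixes \<alpha> \<beta> :: "'i \<Rightarrow> real"
  assumes r: "r \<noteq> 0"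
    and \<phi>: "proj_C1_on {p..q} \<phi>" and fin\<phi>: "finite {x \<in> {p..q}. \<phi> x = None}"
    and le: "\<And>v. v \<in> V \<Longrightarrow> \<alpha> v \<le> \<beta> v"
    and \<psi>: "\<And>v. v \<in> V \<Longrightarrow> proj_C1_on {\<alpha> v..\<beta> v} \<psi>"
    and fin\<psi>: "\<And>v. v \<in> V \<Longrightarrow> finite {y \<in> {\<alpha> v..\<beta> v}. \<psi> y = None}"
    and ne: "\<And>v x y. v \<in> V \<Longrightarrow> x \<in> {p..q} \<Longrightarrow> y \<in> {\<alpha> v..\<beta> v} \<Longrightarrow> \<phi> x \<noteq> \<psi> y"
    and g: "\<And>x y. \<phi> x \<noteq> None \<Longrightarrow> \<psi> y \<noteq> None \<Longrightarrow> g x y = density_formula r \<phi> \<psi> x y"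
    and marginal: "\<And>x. x \<in> {p<..<q} \<Longrightarrow> (\<Sum>v\<in>V. integral {\<alpha> v..\<beta> v} (g x)) = 1"
    and x: "x \<in> {p..q}"
  shows "exp (r * (x - p)) = (\<Prod>v\<in>V. cross_ratio (\<psi> (\<beta> v)) (\<psi> (\<alpha> v)) (\<phi> p) (\<phi> x))"
proof -
  let ?R = "\<lambda>v x. cross_ratio (\<psi> (\<beta> v)) (\<psi> (\<alpha> v)) (\<phi> p) (\<phi> x)"
  let ?P = "\<lambda>x. \<Prod>v\<in>V. ?R v x"
  have ne\<alpha>: "\<phi> z \<noteq> \<psi> (\<alpha> v)" "\<psi> (\<alpha> v) \<noteq> \<phi> z"
    and ne\<beta>: "\<phi> z \<noteq> \<psi> (\<beta> v)" "\<psi> (\<beta> v) \<noteq> \<phi> z" if "v \<in> V" "z \<in> {p..q}" for v z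
    using ne[OF that, of "\<alpha> v"] ne[OF that, of "\<beta> v"] le[OF that(1)] by auto
  have R0: "?R v z \<noteq> 0" if "v \<in> V" "z \<in> {p..q}" for v z
    using that ne\<alpha>[OF that(1), of z] ne\<beta>[OF that(1), of z] ne\<alpha>[OF that(1), of p] ne\<beta>[OF that(1), of p]
    by (auto simp: cross_ratio_def proj_diff_eq_0_iff)
  have "?P x = exp (r * (x - p))"
  proof (rule exp_unique_of_DERIV_finite_exceptions[OF fin\<phi> _ _ _ x])
    have "continuous_on {p..q} (?R v)" if v: "v \<in> V" for v
      unfolding cross_ratio_def
      using \<phi> ne\<beta>(1)[OF v]
      by (intro continuous_on_mult_left continuous_on_proj_diff_ratio) (auto simp: proj_C1_on_def)
    then show "continuous_on {p..q} ?P"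
      by (rule continuous_on_prod)
    have "p \<in> {p..q}" using x by auto
    then have "?R v p = 1" if "v \<in> V" for v
      using R0[OF that, of p] by (auto simp: cross_ratio_def)
    then show "?P p = 1" by simp
  next
    fix z assume z: "z \<in> {p<..<q} - {x \<in> {p..q}. \<phi> x = None}"
    then obtain t where t: "\<phi> z = Some t" by auto
    have zI: "z \<in> {p..q}" "z \<in> {p<..<q}" using z by auto
    let ?d = "deriv (\<lambda>s. coord (\<phi> s)) z"
    let ?h = "\<lambda>v. recip_diff t (\<psi> (\<beta> v)) - recip_diff t (\<psi> (\<alpha> v))"
    have ne_t: "\<psi> y \<noteq> Some t" if "v \<in> V" "y \<in> {\<alpha> v..\<beta> v}" for v y
      using ne[OF that(1) zI(1) that(2)] t by simp
    have int: "integral {\<alpha> v..\<beta> v} (g z) = - (1 / r) * ?d * ?h v" if v: "v \<in> V" for v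
      by (rule integral_unique, rule has_integral_recip_diff[OF le[OF v] \<psi>[OF v] fin\<psi>[OF v]])
         (use ne_t[OF v] t in \<open>auto simp: g density_formula_def coord_def\<close>)
    have sum: "(\<Sum>v\<in>V. - ?d * ?h v) = r"
    proof -
      have "(\<Sum>v\<in>V. - ?d * ?h v) = r * (\<Sum>v\<in>V. integral {\<alpha> v..\<beta> v} (g z))"
        unfolding sum_distrib_left by (rule sum.cong) (use r in \<open>auto simp: int\<close>)
      then show ?thesis using marginal[OF zI(2)] by simp
    qed
    have "(?P has_real_derivative
             ?P z * (\<Sum>v\<in>V. ?R v z * (- ?d * ?h v) / ?R v z)) (at z)"
      by (intro has_field_derivative_prod' DERIV_cross_ratio_last[OF \<phi> fin\<phi> zI(2) t])
         (use R0[OF _ zI(1)] ne\<alpha>[OF _ zI(1)] ne\<beta>[OF _ zI(1)] t in auto)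
    also have "(\<Sum>v\<in>V. ?R v z * (- ?d * ?h v) / ?R v z) = (\<Sum>v\<in>V. - ?d * ?h v)"
      by (rule sum.cong) (use R0[OF _ zI(1)] in auto)
    finally show "(?P has_real_derivative r * ?P z) (at z)"
      unfolding sum by (simp add: mult.commute)
  qed
  then show ?thesis by simp
qed

lemma density_formula_swap: "density_formula r \<psi> \<phi> y x = density_formula r \<phi> \<psi> x y"
  by (simp add: density_formula_def power2_commute mult.commute)

lemma partition_segment_subset:
  fixes X :: "nat \<Rightarrow> real"
  assumes "\<forall>u\<in>{1..k}. X (u - 1) < X u" "u \<in> {1..k}"
  shows "{X (u - 1)..X u} \<subseteq> {X 0..X k}"
proof -
  have X_step: "X n \<le> X (Suc n)" if "n < k" for n
    using assms(1)[rule_format, of "Suc n"] that by simp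
  have mono: "X i \<le> X j" if "i \<le> j" "j \<le> k" for i j
    using that
  proof (induction j rule: dec_induct)
    case (step n)
    then show ?case using X_step[of n] by simp
  qed simp
  show ?thesis
    using mono[of 0 "u - 1"] mono[of u k] assms(2) by auto
qed

lemma sum_zero_one_weight:
  assumes "\<forall>v\<in>A. w v \<in> {0, 1 :: nat}" "finite A"
  shows "(\<Sum>v\<in>A. real (w v) * f v) = (\<Sum>v\<in>{v\<in>A. w v = 1}. f v)"
  using assms by (intro sum.mono_neutral_cong_right) auto

lemma prod_zero_one_exponent:
  fixes f :: "'a \<Rightarrow> 'b :: comm_monoid_mult"
  assumes "\<forall>v\<in>A. w v \<in> {0, 1 :: nat}" "finite A"
  shows "(\<Prod>v\<in>A. f v ^ w v) = (\<Prod>v\<in>{v\<in>A. w v = 1}. f v)"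
  using assms by (intro prod.mono_neutral_cong_right) auto

theorem theorem4p9:
  fixes r :: real
    and k l :: nat
    and I :: "nat \<Rightarrow> nat \<Rightarrow> nat"
    and X Y :: "nat \<Rightarrow> real"
    and \<phi> \<psi> :: "real \<Rightarrow> proj_real"
  assumes "r \<noteq> 0"
    and "convex_array k l I"
    and "X 0 = 0" and "X k = 1" and "\<forall>u\<in>{1..k}. X (u - 1) < X u"
    and "Y 0 = 0" and "Y l = 1" and "\<forall>v\<in>{1..l}. Y (v - 1) < Y v"
    and "continuous_map (top_of_set {0..1}) proj_line \<phi>"
    and "continuous_map (top_of_set {0..1}) proj_line \<psi>"
    and "finite {x \<in> {0..1}. \<phi> x = None}"
    and "finite {y \<in> {0..1}. \<psi> y = None}"
    and "\<forall>u\<in>{1..k}. proj_C1_on {X (u - 1)..X u} \<phi>"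
    and "\<forall>v\<in>{1..l}. proj_C1_on {Y (v - 1)..Y v} \<psi>"
    and "\<forall>u\<in>{1..k}. \<forall>v\<in>{1..l}. I u v = 1 \<longrightarrow>
           (\<forall>x\<in>{X (u - 1)..X u}. \<forall>y\<in>{Y (v - 1)..Y v}. \<phi> x \<noteq> \<psi> y)"
    and "\<forall>u\<in>{1..k}. \<forall>v\<in>{1..l}. I u v = 1 \<longrightarrow>
           (\<forall>x\<in>{X (u - 1)<..<X u}. \<forall>y\<in>{Y (v - 1)<..<Y v}. permuton_density r \<phi> \<psi> x y \<ge> 0)"
    and "\<forall>u\<in>{1..k}. \<forall>x\<in>{X (u - 1)<..<X u}.
           (\<Sum>v=1..l. real (I u v) * integral {Y (v - 1)..Y v} (\<lambda>y. permuton_density r \<phi> \<psi> x y)) = 1"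
    and "\<forall>v\<in>{1..l}. \<forall>y\<in>{Y (v - 1)<..<Y v}.
           (\<Sum>u=1..k. real (I u v) * integral {X (u - 1)..X u} (\<lambda>x. permuton_density r \<phi> \<psi> x y)) = 1"
  shows "(\<forall>u\<in>{1..k}. exp (r * (X u - X (u - 1))) =
            (\<Prod>v=1..l. cross_ratio (\<psi> (Y v)) (\<psi> (Y (v - 1))) (\<phi> (X (u - 1))) (\<phi> (X u)) ^ I u v)) \<and>
         (\<forall>v\<in>{1..l}. exp (r * (Y v - Y (v - 1))) =
            (\<Prod>u=1..k. cross_ratio (\<psi> (Y v)) (\<psi> (Y (v - 1))) (\<phi> (X (u - 1))) (\<phi> (X u)) ^ I u v)) \<and>
         (\<forall>u\<in>{1..k}. \<forall>x\<in>{X (u - 1)..X u}. exp (r * (x - X (u - 1))) =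
            (\<Prod>v=1..l. cross_ratio (\<psi> (Y v)) (\<psi> (Y (v - 1))) (\<phi> (X (u - 1))) (\<phi> x) ^ I u v)) \<and>
         (\<forall>v\<in>{1..l}. \<forall>y\<in>{Y (v - 1)..Y v}. exp (r * (y - Y (v - 1))) =
            (\<Prod>u=1..k. cross_ratio (\<psi> y) (\<psi> (Y (v - 1))) (\<phi> (X (u - 1))) (\<phi> (X u)) ^ I u v))"
proof -
  note r = assms(1) and conv = assms(2) and X = assms(3-5) and Y = assms(6-8)
    and finite_\<phi> = assms(11) and finite_\<psi> = assms(12) and C1_\<phi> = assms(13) and C1_\<psi> = assms(14)
    and disjoint = assms(15) and marginals = assms(17,18)
  have I01: "\<forall>u\<in>{1..k}. \<forall>v\<in>{1..l}. I u v \<in> {0, 1}"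
    using conv by (simp add: convex_array_def)
  have fin\<phi>: "finite {x \<in> {X (u - 1)..X u}. \<phi> x = None}" if "u \<in> {1..k}" for u
    by (rule finite_subset[OF _ finite_\<phi>])
       (use partition_segment_subset[OF X(3) that] X in auto)
  have fin\<psi>: "finite {y \<in> {Y (v - 1)..Y v}. \<psi> y = None}" if "v \<in> {1..l}" for v
    by (rule finite_subset[OF _ finite_\<psi>])
       (use partition_segment_subset[OF Y(3) that] Y in auto)
  have A: "exp (r * (x - X (u - 1))) =
      (\<Prod>v=1..l. cross_ratio (\<psi> (Y v)) (\<psi> (Y (v - 1))) (\<phi> (X (u - 1))) (\<phi> x) ^ I u v)"
    if u: "u \<in> {1..k}" and x: "x \<in> {X (u - 1)..X u}" for u x
  proof -
    have w: "\<forall>v\<in>{1..l}. I u v \<in> {0, 1}" using I01 u by blast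
    show ?thesis
      unfolding prod_zero_one_exponent[OF w finite_atLeastAtMost]
    proof (rule marginal_imp_cross_ratio_product
        [where g = "permuton_density r \<phi> \<psi>", OF r C1_\<phi>[rule_format, OF u] fin\<phi>[OF u] _ _ _ _ _ _ x])
      show "(\<Sum>v\<in>{v\<in>{1..l}. I u v = 1}. integral {Y (v - 1)..Y v} (permuton_density r \<phi> \<psi> x)) = 1"
        if "x \<in> {X (u - 1)<..<X u}" for x
        using marginals(1)[rule_format, OF u that] unfolding sum_zero_one_weight[OF w finite_atLeastAtMost] .
    qed (use u C1_\<psi> fin\<psi> Y(3) disjoint in \<open>auto simp: permuton_density_def less_imp_le\<close>)
  qed
  have B: "exp (r * (y - Y (v - 1))) =
      (\<Prod>u=1..k. cross_ratio (\<psi> y) (\<psi> (Y (v - 1))) (\<phi> (X (u - 1))) (\<phi> (X u)) ^ I u v)"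
    if v: "v \<in> {1..l}" and y: "y \<in> {Y (v - 1)..Y v}" for v y
  proof -
    have w: "\<forall>u\<in>{1..k}. I u v \<in> {0, 1}" using I01 v by blast
    have swap: "cross_ratio (\<psi> y) (\<psi> (Y (v - 1))) (\<phi> (X (u - 1))) (\<phi> (X u))
        = cross_ratio (\<phi> (X u)) (\<phi> (X (u - 1))) (\<psi> (Y (v - 1))) (\<psi> y)" for u
      by (rule trans[OF cross_ratio_symmetries(2)[symmetric] cross_ratio_symmetries(1)[symmetric]])
    show ?thesis
      unfolding prod_zero_one_exponent[OF w finite_atLeastAtMost] swap
    proof (rule marginal_imp_cross_ratio_product
        [where g = "\<lambda>y x. permuton_density r \<phi> \<psi> x y",
          OF r C1_\<psi>[rule_format, OF v] fin\<psi>[OF v] _ _ _ _ _ _ y])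
      show "(\<Sum>u\<in>{u\<in>{1..k}. I u v = 1}.
          integral {X (u - 1)..X u} (\<lambda>x. permuton_density r \<phi> \<psi> x y)) = 1"
        if "y \<in> {Y (v - 1)<..<Y v}" for y
        using marginals(2)[rule_format, OF v that] unfolding sum_zero_one_weight[OF w finite_atLeastAtMost] .
      show "\<psi> y \<noteq> \<phi> x"
        if "u \<in> {u\<in>{1..k}. I u v = 1}" "y \<in> {Y (v - 1)..Y v}" "x \<in> {X (u - 1)..X u}" for u x y
        using disjoint v that by fastforce
    qed (use v C1_\<phi> fin\<phi> X(3) in \<open>auto simp: permuton_density_def density_formula_swap less_imp_le\<close>)
  qed
  have "X u \<in> {X (u - 1)..X u}" if "u \<in> {1..k}" for u
    using X(3) that by (simp add: less_imp_le)
  moreover have "Y v \<in> {Y (v - 1)..Y v}" if "v \<in> {1..l}" for v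
    using Y(3) that by (simp add: less_imp_le)
  ultimately show ?thesis
    using A B by simp
qed

end
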